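(* Let $(q,\boldsymbol{\mathcal F}_q,\boldsymbol{\mathcal G}_q,\boldsymbol c_q)$ be a secondary structure of the conservation law $\partial_t\boldsymbol u+\sum_{i=1}^d\partial_{x_i}\boldsymbol f^i(\boldsymbol u)=0$. For $j=1,\dots,d$ let $\boldsymbol f_h^j:\mathcal U\times\mathcal U\to\mathbb R^n$ be symmetric and consistent numerical flux functions, and let $W^j:\mathcal U\times\mathcal U\to\mathbb R$ (written $[c_q^j\Delta\mathcal G_q^j]$ in the source) be anti-symmetric and consistent numerical work terms satisfying the weak discrete null-consistency property $$\Delta\boldsymbol\xi(\boldsymbol u,\boldsymbol v)=0\ \Longrightarrow\ \Delta\psi_q^j(\boldsymbol u,\boldsymbol v)=W^j(\boldsymbol u,\boldsymbol v)\qquad\text{for all }\boldsymbol u,\boldsymbol v\in\mathcal U .$$ Suppose that for every $j=1,\dots,d$ the generalized Tadmor condition holds: $$\Delta\psi_q^j(\boldsymbol u,\boldsymbol v)-\boldsymbol f_h^j(\boldsymbol u,\boldsymbol v)^T\Delta\boldsymbol\xi(\boldsymbol u,\boldsymbol v)=W^j(\boldsymbol u,\boldsymbol v)\qquad\text{for all }\boldsymbol u,\boldsymbol v\in\mathcal U .$$ Then every solution $(\boldsymbol u_{\boldsymbol I}(t))_{\boldsymbol I}$, with values in $\mathcal U$, of the finite-volume scheme $$\frac{d\boldsymbol u_{\boldsymbol I}}{dt}+\sum_{j=1}^d\frac1{\Delta x_j}\Big(\boldsymbol f^j_{\boldsymbol I+\boldsymbol 1_j/2}-\boldsymbol f^j_{\boldsymbol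 I-\boldsymbol 1_j/2}\Big)=0$$ also satisfies, with $q_{\boldsymbol I}:=q(\boldsymbol u_{\boldsymbol I})$, the discrete balance law $$\frac{dq_{\boldsymbol I}}{dt}+\sum_{j=1}^d\frac1{\Delta x_j}\Big(\mathcal F^j_{q,\boldsymbol I+\boldsymbol 1_j/2}-\mathcal F^j_{q,\boldsymbol I-\boldsymbol 1_j/2}\Big)+\sum_{j=1}^d\frac12\left(\frac{W^j_{\boldsymbol I+\boldsymbol 1_j/2}}{\Delta x_j}+\frac{W^j_{\boldsymbol I-\boldsymbol 1_j/2}}{\Delta x_j}\right)=0,$$ where $\mathcal F^j_{q,\boldsymbol I+\boldsymbol 1_j/2}=\mathcal F^j_{q,h}(\boldsymbol u_{\boldsymbol I},\boldsymbol u_{\boldsymbol I+\boldsymbol 1_j})$ and $\mathcal F_{q,h}^j(\boldsymbol u,\boldsymbol v):=\overline{\boldsymbol\xi}(\boldsymbol u,\boldsymbol v)^T\boldsymbol f_h^j(\boldsymbol u,\boldsymbol v)-\overline{\psi}_q^j(\boldsymbol u,\boldsymbol v)$ is a symmetric numerical flux consistent with $\mathcal F_q^j$, i.e. $\mathcal F_{q,h}^j(\boldsymbol u,\boldsymbol v)=\mathcal F_{q,h}^j(\boldsymbol v,\boldsymbol u)$ and $\mathcal F_{q,h}^j(\boldsymbol u,\boldsymbol u)=\mathcal F_q^j(\boldsymbol u)$.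
   Context: Setting: $d,n\in\mathbb N$, $\mathcal U\subseteq\mathbb R^n$ is open, and $\boldsymbol f^i:\mathcal U\to\mathbb R^n$, $i=1,\dots,d$, are $C^1$ flux functions. Secondary structure: a tuple $(q,\boldsymbol{\mathcal F}_q,\boldsymbol{\mathcal G}_q,\boldsymbol c_q)$ with $q:\mathcal U\to\mathbb R$ of class $C^2$ (not necessarily convex), $\mathcal F_q^i,\mathcal G_q^i:\mathcal U\to\mathbb R$ of class $C^1$ and $c_q^i:\mathcal U\to\mathbb R$ ($i=1,\dots,d$), such that, with $\boldsymbol\xi(\boldsymbol u):=\frac{\partial q}{\partial\boldsymbol u}(\boldsymbol u)\in\mathbb R^n$, $$\boldsymbol\xi(\boldsymbol u)^T\frac{\partial\boldsymbol f^i}{\partial\boldsymbol u}(\boldsymbol u)=\Big(\frac{\partial\mathcal F_q^i}{\partial\boldsymbol u}(\boldsymbol u)\Big)^T+c_q^i(\boldsymbol u)\Big(\frac{\partial\mathcal G_q^i}{\partial\boldsymbol u}(\boldsymbol u)\Big)^T,\qquad \boldsymbol u\in\mathcal U,\ i=1,\dots,d .$$ The residual function is $\psi_q^i(\boldsymbol u):=\boldsymbol\xi(\boldsymbol u)^T\boldsymbol f^i(\boldsymbol u)-\mathcal F_q^i(\boldsymbol u)$. For any function $g$ on $\mathcal U$: $\overline g(\boldsymbol u,\boldsymbol v):=\frac{g(\boldsymbol u)+g(\boldsymbol v)}2$ and $\Delta g(\boldsymbol u,\boldsymbol v):=g(\boldsymbol v)-g(\boldsymbol u)$. Numerical flux: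 $\boldsymbol f_h^j$ is consistent if $\boldsymbol f_h^j(\boldsymbol u,\boldsymbol u)=\boldsymbol f^j(\boldsymbol u)$ and symmetric if $\boldsymbol f_h^j(\boldsymbol u,\boldsymbol v)=\boldsymbol f_h^j(\boldsymbol v,\boldsymbol u)$ for all $\boldsymbol u,\boldsymbol v\in\mathcal U$. Numerical work term: $W^j$ is anti-symmetric if $W^j(\boldsymbol u,\boldsymbol v)=-W^j(\boldsymbol v,\boldsymbol u)$ for all $\boldsymbol u,\boldsymbol v$. It is consistent if, divided by the cell width, it is a consistent approximation of the non-conservative term $c_q^j\,\partial_{x_j}\mathcal G_q^j$, i.e. for every $C^1$ curve $x\mapsto\boldsymbol u(x)\in\mathcal U$, $W^j(\boldsymbol u(x),\boldsymbol u(x+h))/h\to c_q^j(\boldsymbol u(x))\frac{d}{dx}\mathcal G_q^j(\boldsymbol u(x))$ as $h\to0^+$. Grid: cells are indexed by multi-indices $\boldsymbol I=(i_1,\dots,i_d)$; $\boldsymbol 1_j$ is the multi-index with $1$ in position $j$ and $0$ elsewhere; $\Delta x_j>0$ is the uniform cell width in direction $j$. For a two-point function $\phi$ write $\phi_{\boldsymbol I+\boldsymbol 1_j/2}:=\phi(\boldsymbol u_{\boldsymbol I},\boldsymbol u_{\boldsymbol I+\boldsymbol 1_j})$ and $\phi_{\boldsymbol I-\boldsymbol 1_j/2}:=\phi(\boldsymbol u_{\boldsymbol I-\boldsymbol 1_j},\boldsymbol u_{\boldsymbol I})$. The equations are understood at every cell $\boldsymbol I$ whose neighbours $\boldsymbol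 I\pm\boldsymbol 1_j$ all exist (e.g. all cells of a periodic or infinite grid). *)

theory Defs
  imports "HOL-Analysis.Analysis"
begin

text \<open>
  States live in \<open>real ^ 'n\<close>; the space directions are the elements of the finite type \<open>'d\<close>,
  and cells are multi-indices in \<open>int ^ 'd\<close>, the multi-index \<open>1\<^sub>j\<close> being \<open>axis j 1\<close>.
  State functions are total; only their values on the open state set \<open>U\<close> matter.
\<close>

definition C1_on :: "'a set \<Rightarrow> ('a::real_normed_vector \<Rightarrow> 'b::real_normed_vector) \<Rightarrow> bool" where
  "C1_on U g \<longleftrightarrow>
     (\<exists>g'. (\<forall>x\<in>U. (g has_derivative blinfun_apply (g' x)) (at x)) \<and> continuous_on U g')"

definition C2_on :: "'a set \<Rightarrow> ('a::real_normed_vector \<Rightarrow> 'b::real_normed_vector) \<Rightarrow> bool" where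
  "C2_on U g \<longleftrightarrow>
     (\<exists>g'. (\<forall>x\<in>U. (g has_derivative blinfun_apply (g' x)) (at x)) \<and> C1_on U g')"

text \<open>The vector of partial derivatives; meaningful where \<open>g\<close> is differentiable.\<close>

definition grad :: "(real ^ 'n \<Rightarrow> real) \<Rightarrow> real ^ 'n \<Rightarrow> real ^ 'n" where
  "grad g u = (\<chi> k. frechet_derivative g (at u) (axis k 1))"

definition avg :: "('a \<Rightarrow> 'b::real_vector) \<Rightarrow> 'a \<Rightarrow> 'a \<Rightarrow> 'b" where
  "avg g u v = (g u + g v) /\<^sub>R 2"

definition jump :: "('a \<Rightarrow> 'b::real_vector) \<Rightarrow> 'a \<Rightarrow> 'a \<Rightarrow> 'b" where
  "jump g u v = g v - g u"

definition secondary_structure ::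
  "(real ^ 'n) set \<Rightarrow> ('d \<Rightarrow> real ^ 'n \<Rightarrow> real ^ 'n) \<Rightarrow> (real ^ 'n \<Rightarrow> real) \<Rightarrow>
   ('d \<Rightarrow> real ^ 'n \<Rightarrow> real) \<Rightarrow> ('d \<Rightarrow> real ^ 'n \<Rightarrow> real) \<Rightarrow> ('d \<Rightarrow> real ^ 'n \<Rightarrow> real) \<Rightarrow> bool"
where
  "secondary_structure U f q F G c \<longleftrightarrow>
     C2_on U q \<and> (\<forall>i. C1_on U (F i)) \<and> (\<forall>i. C1_on U (G i)) \<and>
     (\<forall>i. \<forall>u\<in>U. grad q u v* jacobian (f i) (at u) = grad (F i) u + c i u *\<^sub>R grad (G i) u)"

text \<open>The residual function of one direction, with \<open>f\<close> and \<open>F\<close> the fluxes in that direction.\<close>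

definition residual ::
  "(real ^ 'n \<Rightarrow> real) \<Rightarrow> (real ^ 'n \<Rightarrow> real ^ 'n) \<Rightarrow> (real ^ 'n \<Rightarrow> real) \<Rightarrow> real ^ 'n \<Rightarrow> real"
where
  "residual q f F u = grad q u \<bullet> f u - F u"

definition flux_symmetric :: "'a set \<Rightarrow> ('a \<Rightarrow> 'a \<Rightarrow> 'b) \<Rightarrow> bool" where
  "flux_symmetric U \<phi> \<longleftrightarrow> (\<forall>u\<in>U. \<forall>v\<in>U. \<phi> u v = \<phi> v u)"

definition flux_consistent :: "'a set \<Rightarrow> ('a \<Rightarrow> 'a \<Rightarrow> 'b) \<Rightarrow> ('a \<Rightarrow> 'b) \<Rightarrow> bool" where
  "flux_consistent U \<phi> g \<longleftrightarrow> (\<forall>u\<in>U. \<phi> u u = g u)"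

definition work_antisymmetric :: "'a set \<Rightarrow> ('a \<Rightarrow> 'a \<Rightarrow> real) \<Rightarrow> bool" where
  "work_antisymmetric U W \<longleftrightarrow> (\<forall>u\<in>U. \<forall>v\<in>U. W u v = - W v u)"

definition work_consistent ::
  "(real ^ 'n) set \<Rightarrow> (real ^ 'n \<Rightarrow> real ^ 'n \<Rightarrow> real) \<Rightarrow> (real ^ 'n \<Rightarrow> real) \<Rightarrow> (real ^ 'n \<Rightarrow> real) \<Rightarrow> bool"
where
  "work_consistent U W c G \<longleftrightarrow>
     (\<forall>\<gamma> a b. \<gamma> C1_differentiable_on {a<..<b} \<and> \<gamma> ` {a<..<b} \<subseteq> U \<longrightarrow>
       (\<forall>x\<in>{a<..<b}.
         ((\<lambda>h. W (\<gamma> x) (\<gamma> (x + h)) / h) \<longlongrightarrow> c (\<gamma> x) * deriv (\<lambda>y. G (\<gamma> y)) x) (at_right 0)))"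

definition secondary_flux ::
  "(real ^ 'n \<Rightarrow> real) \<Rightarrow> (real ^ 'n \<Rightarrow> real ^ 'n) \<Rightarrow> (real ^ 'n \<Rightarrow> real) \<Rightarrow>
   (real ^ 'n \<Rightarrow> real ^ 'n \<Rightarrow> real ^ 'n) \<Rightarrow> real ^ 'n \<Rightarrow> real ^ 'n \<Rightarrow> real"
where
  "secondary_flux q f F fh u v = avg (grad q) u v \<bullet> fh u v - avg (residual q f F) u v"

text \<open>
  The grid is an arbitrary set \<open>C\<close> of cells; \<open>C = UNIV\<close> is the infinite grid, and a periodic grid
  is the infinite grid with periodic cell values.
\<close>

definition interior_cells :: "(int ^ 'd) set \<Rightarrow> (int ^ 'd) set" where
  "interior_cells C = {I \<in> C. \<forall>j. I + axis j 1 \<in> C \<and> I - axis j 1 \<in> C}"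

text \<open>Two-point functions at the faces \<open>I + 1\<^sub>j/2\<close> and \<open>I - 1\<^sub>j/2\<close>.\<close>

definition right_face :: "('a \<Rightarrow> 'a \<Rightarrow> 'b) \<Rightarrow> (int ^ 'd \<Rightarrow> 'a) \<Rightarrow> 'd \<Rightarrow> int ^ 'd \<Rightarrow> 'b" where
  "right_face \<phi> u j I = \<phi> (u I) (u (I + axis j 1))"

definition left_face :: "('a \<Rightarrow> 'a \<Rightarrow> 'b) \<Rightarrow> (int ^ 'd \<Rightarrow> 'a) \<Rightarrow> 'd \<Rightarrow> int ^ 'd \<Rightarrow> 'b" where
  "left_face \<phi> u j I = \<phi> (u (I - axis j 1)) (u I)"

text \<open>
  \<open>u t I\<close> is the value in cell \<open>I\<close> at time \<open>t\<close>. Time derivatives are taken within the time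
  interval \<open>T\<close>, hence are one-sided at end points belonging to \<open>T\<close>.
\<close>

definition scheme_solution ::
  "(real ^ 'n) set \<Rightarrow> ('d::finite \<Rightarrow> real ^ 'n \<Rightarrow> real ^ 'n \<Rightarrow> real ^ 'n) \<Rightarrow> ('d \<Rightarrow> real) \<Rightarrow>
   (int ^ 'd) set \<Rightarrow> real set \<Rightarrow> (real \<Rightarrow> int ^ 'd \<Rightarrow> real ^ 'n) \<Rightarrow> bool"
where
  "scheme_solution U fh dx C T u \<longleftrightarrow>
     (\<forall>t\<in>T. \<forall>I\<in>C. u t I \<in> U) \<and>
     (\<forall>t\<in>T. \<forall>I\<in>interior_cells C. \<exists>D.
        ((\<lambda>s. u s I) has_vector_derivative D) (at t within T) \<and>
        D + (\<Sum>j\<in>UNIV. (1 / dx j) *\<^sub>R (right_face (fh j) (u t) j I - left_face (fh j) (u t) j I)) = 0)"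

end

theory Submission
  imports Defs
begin

text \<open>
  Multiplying the scheme by \<open>\<xi> = grad q\<close> at the cell value turns \<open>du/dt\<close> into \<open>dq/dt\<close> by the chain
  rule, and each flux difference into \<open>\<xi>(u\<^sub>I) \<bullet> (f\<^sub>h(u\<^sub>I, u\<^sub>R) - f\<^sub>h(u\<^sub>L, u\<^sub>I))\<close>, with \<open>u\<^sub>L\<close>, \<open>u\<^sub>R\<close> the values
  in the two neighbours. So one only has to write a face contribution \<open>\<xi> \<bullet> f\<^sub>h\<close>, with \<open>\<xi>\<close> taken on one
  side of the face, as a quantity that both adjacent cells share, plus a work term, plus a term that
  depends on the cell value alone and therefore cancels between the two faces of the cell.

  This is what the Tadmor condition does. On the face between \<open>u\<close> and \<open>v\<close> replace the one-sided
  values \<open>\<xi>(u)\<close>, \<open>\<psi>(u)\<close> by averages minus half jumps: \<open>\<xi>(u) \<bullet> f\<^sub>h - \<psi>(u)\<close> is the secondary flux plus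
  half of \<open>\<Delta>\<psi> - f\<^sub>h \<bullet> \<Delta>\<xi>\<close>, and the latter is \<open>W\<close>. Seen from \<open>v\<close> the half jumps enter with the opposite
  sign, so \<open>\<xi>(v) \<bullet> f\<^sub>h - \<psi>(v)\<close> is the same flux minus \<open>W / 2\<close> (lemmas \<open>secondary_flux_from_left\<close> and
  \<open>secondary_flux_from_right\<close>). In the difference over a cell the residual \<open>\<psi>(u\<^sub>I)\<close> cancels, and the
  two half work terms, one from each face, add up (\<open>tadmor_cell_balance\<close>).
\<close>

lemma grad_inner_eq_derivative:
  fixes g :: "real ^ 'n \<Rightarrow> real"
  assumes "(g has_derivative g') (at u)"
  shows "g' h = grad g u \<bullet> h"
proof -
  have lin: "linear g'"
    using assms has_derivative_linear by blast
  have "g' h = g' (\<Sum>k\<in>UNIV. (h $ k) *\<^sub>R axis k 1)"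
    by (simp add: basis_expansion[of h, unfolded scalar_mult_eq_scaleR])
  also have "\<dots> = (\<Sum>k\<in>UNIV. (h $ k) * g' (axis k 1))"
    by (simp add: linear_sum[OF lin] linear_scale[OF lin])
  also have "\<dots> = grad g u \<bullet> h"
    by (simp add: grad_def inner_vec_def frechet_derivative_at[OF assms, symmetric] mult.commute)
  finally show ?thesis .
qed

lemma C2_on_chain_rule:
  fixes g :: "real ^ 'n \<Rightarrow> real" and x :: "real \<Rightarrow> real ^ 'n"
  assumes "C2_on U g" and "x t \<in> U" and "(x has_vector_derivative D) (at t within T)"
  shows "((\<lambda>s. g (x s)) has_real_derivative grad g (x t) \<bullet> D) (at t within T)"
proof -
  obtain g' where g': "(g has_derivative g') (at (x t))"
    using assms(1,2) unfolding C2_on_def by blast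
  have "((g \<circ> x) has_vector_derivative g' D) (at t within T)"
    using vector_derivative_diff_chain_within[OF assms(3) has_derivative_at_withinI[OF g']] .
  then show ?thesis
    by (simp add: grad_inner_eq_derivative[OF g'] o_def
        has_real_derivative_iff_has_vector_derivative)
qed

lemma secondary_flux_symmetric:
  assumes "flux_symmetric U fh"
  shows "flux_symmetric U (secondary_flux q f F fh)"
  using assms by (simp add: flux_symmetric_def secondary_flux_def avg_def add.commute)

text \<open>
  On the diagonal the secondary flux is \<open>\<xi> \<bullet> f - \<psi>\<close>, and the residual \<open>\<psi>\<close> is defined so that
  this is \<open>F\<close>.
\<close>

lemma secondary_flux_consistent:
  assumes "flux_consistent U fh f"
  shows "flux_consistent U (secondary_flux q f F fh) F"
  using assms
  by (simp add: flux_consistent_def secondary_flux_def avg_def residual_def diff_divide_distrib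
      flip: scaleR_2)

text \<open>
  The shared secondary flux, expressed with \<open>\<xi>\<close> and \<open>\<psi>\<close> on a single side of the face. An average is the
  left value plus half the jump, and the right value minus half the jump; the sign of \<open>W\<close> follows.
\<close>

lemma secondary_flux_from_left:
  assumes "jump (residual q f F) u v - fh u v \<bullet> jump (grad q) u v = w"
  shows "secondary_flux q f F fh u v = grad q u \<bullet> fh u v - residual q f F u - w / 2"
  unfolding secondary_flux_def avg_def assms[symmetric] jump_def
  by (simp add: inner_add_left inner_diff_right inner_commute[of "fh u v"])
    (simp add: field_simps)

lemma secondary_flux_from_right:
  assumes "jump (residual q f F) u v - fh u v \<bullet> jump (grad q) u v = w"
  shows "secondary_flux q f F fh u v = grad q v \<bullet> fh u v - residual q f F v + w / 2"
  unfolding secondary_flux_def avg_def assms[symmetric] jump_def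
  by (simp add: inner_add_left inner_diff_right inner_commute[of "fh u v"])
    (simp add: field_simps)

text \<open>
  The balance of one direction over the cell with value \<open>b\<close> and neighbour values \<open>a\<close>, \<open>b'\<close>: at both faces
  the flux is expressed from the side of \<open>b\<close>, so that the two occurrences of \<open>\<psi>(b)\<close> cancel.
\<close>

lemma tadmor_cell_balance:
  assumes left: "jump (residual q f F) a b - fh a b \<bullet> jump (grad q) a b = W a b"
    and right: "jump (residual q f F) b b' - fh b b' \<bullet> jump (grad q) b b' = W b b'"
  shows "grad q b \<bullet> (fh b b' - fh a b)
         = (secondary_flux q f F fh b b' - secondary_flux q f F fh a b) + (W b b' + W a b) / 2"
  unfolding secondary_flux_from_left[where fh=fh, OF right]
    secondary_flux_from_right[where fh=fh, OF left]
  by (simp add: inner_diff_right field_simps)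

theorem theorem1:
  fixes U :: "(real ^ 'n) set"
    and f :: "'d::finite \<Rightarrow> real ^ 'n \<Rightarrow> real ^ 'n"
    and q :: "real ^ 'n \<Rightarrow> real"
    and F G c :: "'d \<Rightarrow> real ^ 'n \<Rightarrow> real"
    and fh :: "'d \<Rightarrow> real ^ 'n \<Rightarrow> real ^ 'n \<Rightarrow> real ^ 'n"
    and W :: "'d \<Rightarrow> real ^ 'n \<Rightarrow> real ^ 'n \<Rightarrow> real"
  assumes "open U"
    and "\<And>i. C1_on U (f i)"
    and "secondary_structure U f q F G c"
    and "\<And>j. flux_symmetric U (fh j)"
    and "\<And>j. flux_consistent U (fh j) (f j)"
    and "\<And>j. work_antisymmetric U (W j)"
    and "\<And>j. work_consistent U (W j) (c j) (G j)"
    and null_consistency: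
      "\<And>j u v. \<lbrakk>u \<in> U; v \<in> U; jump (grad q) u v = 0\<rbrakk>
         \<Longrightarrow> jump (residual q (f j) (F j)) u v = W j u v"
    and tadmor:
      "\<And>j u v. \<lbrakk>u \<in> U; v \<in> U\<rbrakk>
         \<Longrightarrow> jump (residual q (f j) (F j)) u v - fh j u v \<bullet> jump (grad q) u v = W j u v"
  shows "(\<forall>j. flux_symmetric U (secondary_flux q (f j) (F j) (fh j)) \<and>
              flux_consistent U (secondary_flux q (f j) (F j) (fh j)) (F j)) \<and>
         (\<forall>(dx :: 'd \<Rightarrow> real) (C :: (int ^ 'd) set) (T :: real set) u.
            (\<forall>j. dx j > 0) \<and> is_interval T \<and> interior T \<noteq> {} \<and> scheme_solution U fh dx C T u \<longrightarrow>
            (\<forall>t\<in>T. \<forall>I\<in>interior_cells C. \<exists>D.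
               ((\<lambda>s. q (u s I)) has_real_derivative D) (at t within T) \<and>
               D
               + (\<Sum>j\<in>UNIV. (1 / dx j) *
                    (right_face (secondary_flux q (f j) (F j) (fh j)) (u t) j I
                     - left_face (secondary_flux q (f j) (F j) (fh j)) (u t) j I))
               + (\<Sum>j\<in>UNIV. (1 / 2) *
                    (right_face (W j) (u t) j I / dx j + left_face (W j) (u t) j I / dx j)) = 0))"
proof -
  let ?Q = "\<lambda>j. secondary_flux q (f j) (F j) (fh j)"
  have C2: "C2_on U q"
    using assms(3) by (simp add: secondary_structure_def)
  have balance: "\<exists>D. ((\<lambda>s. q (u s I)) has_real_derivative D) (at t within T) \<and>
      D + (\<Sum>j\<in>UNIV. (1 / dx j) * (right_face (?Q j) (u t) j I - left_face (?Q j) (u t) j I))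
        + (\<Sum>j\<in>UNIV. (1 / 2) * (right_face (W j) (u t) j I / dx j + left_face (W j) (u t) j I / dx j))
      = 0"
    if sol: "scheme_solution U fh dx C T u" and t: "t \<in> T" and I: "I \<in> interior_cells C"
    for dx :: "'d \<Rightarrow> real" and C :: "(int ^ 'd) set" and T :: "real set" and u t I
  proof -
    let ?\<xi> = "grad q (u t I)"
    let ?df = "\<lambda>j. right_face (fh j) (u t) j I - left_face (fh j) (u t) j I"
    let ?dQ = "\<lambda>j. right_face (?Q j) (u t) j I - left_face (?Q j) (u t) j I"
    have cells: "u t I \<in> U" "u t (I + axis j 1) \<in> U" "u t (I - axis j 1) \<in> U" for j
      using sol t I by (auto simp: scheme_solution_def interior_cells_def)
    obtain D where D: "((\<lambda>s. u s I) has_vector_derivative D) (at t within T)"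
      and scheme: "D + (\<Sum>j\<in>UNIV. (1 / dx j) *\<^sub>R ?df j) = 0"
      using sol t I unfolding scheme_solution_def by blast
    have face: "?\<xi> \<bullet> ?df j
        = ?dQ j + (right_face (W j) (u t) j I + left_face (W j) (u t) j I) / 2" for j
      unfolding right_face_def left_face_def
      by (intro tadmor_cell_balance tadmor cells)
    have "0 = ?\<xi> \<bullet> (D + (\<Sum>j\<in>UNIV. (1 / dx j) *\<^sub>R ?df j))"
      by (simp add: scheme)
    also have "\<dots> = ?\<xi> \<bullet> D + (\<Sum>j\<in>UNIV. (1 / dx j) * (?\<xi> \<bullet> ?df j))"
      by (simp add: inner_add_right inner_sum_right)
    also have "\<dots> = ?\<xi> \<bullet> D + (\<Sum>j\<in>UNIV. (1 / dx j) * ?dQ j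
        + (1 / 2) * (right_face (W j) (u t) j I / dx j + left_face (W j) (u t) j I / dx j))"
      unfolding face by (simp add: distrib_left add_divide_distrib mult.commute)
    finally have "?\<xi> \<bullet> D + (\<Sum>j\<in>UNIV. (1 / dx j) * ?dQ j)
        + (\<Sum>j\<in>UNIV. (1 / 2) * (right_face (W j) (u t) j I / dx j + left_face (W j) (u t) j I / dx j)) = 0"
      by (simp add: sum.distrib)
    then show ?thesis
      using C2_on_chain_rule[where x="\<lambda>s. u s I", OF C2 cells(1) D] by blast
  qed
  show ?thesis
    using secondary_flux_symmetric[OF assms(4)] secondary_flux_consistent[OF assms(5)] balance
    by blast
qed

end
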